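(* Let $E_2,Y_1,Z,d_0$ be produced by the cellular joint construction described in the context, with angular parameters $\alpha=a/r$, $q_{\rm res}=a/b$, $L_0=\log\alpha^{-1}$, $L_+=\max\{1,L_0\}$, $$A_{\rm ang}=e^{L_+^{1/2}},\quad B_{\rm ang}=e^{L_+^{3/4}},\quad K=1+\lceil\log_{B_{\rm ang}}(q_{\rm res}^{-1})\rceil,\quad J_\theta=1+\lceil\log_2(q_{\rm res}^{-1})\rceil,\quad J_d=1+\lceil\log_2(2A_{\rm ang}^K)\rceil .$$ There exist an edge subset $E_{\rm ang}\subset E_2$ with cellular parent shading $Z_{\rm ang}(B)=\bigcup_{Q:(B,Q)\in E_{\rm ang}}Q$, a dyadic degree $d_{\rm ang}$, a number $\theta\in[q_{\rm res},1]$ and a number $c_{\rm ang}>0$ such that, calling a cell $Q$ retained if $\mathcal F_{\rm ang}(Q):=\{B:(B,Q)\in E_{\rm ang}\}\neq\varnothing$: (A1) every retained cell satisfies $|\mathcal F_{\rm ang}(Q)|\in[d_{\rm ang},2d_{\rm ang})$; (A2) every retained cell satisfies $M_{q_{\rm res}}(\mathcal F_{\rm ang}(Q))\in[\theta,2\theta)$; (A3) for every retained cell $Q$, every $\mathcal H\subset\mathcal F_{\rm ang}(Q)$ with $|\mathcal H|\ge A_{\rm ang}^{-1}|\mathcal F_{\rm ang}(Q)|$ has $M_{q_{\rm res}}(\mathcal H)>\theta/B_{\rm ang}$; (A4) $\displaystyle\sum_B|Z_{\rm ang}(B)|\ge c_{\rm ang}\sum_B|Z(B)|$ with $\displaystyle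 c_{\rm ang}\ge\frac{A_{\rm ang}^{-K}}{J_\theta J_d}$; more explicitly, with an absolute constant $C$, $$c_{\rm ang}^{-1}\le C(1+L_+)^2\exp\bigl(L_+^{3/4}+2L_+^{1/2}\bigr).$$ Consequently $c_{\rm ang}^{-1}=O(1)$ on $L_0\le1$, while $c_{\rm ang}=\alpha^{o(1)}$ as $\alpha\downarrow0$. The corresponding child lift $Y_{\rm ang}(T)=Y_1(T)\cap Z_{\rm ang}(B)$ $(T\in\mathcal T_B)$ satisfies $M(Y_{\rm ang})\ge\frac{c_{\rm ang}}2M(Y_1)$.
   Context: Families are finite and labelled (coincident carriers with different labels are distinct; sums count labels). $|\cdot|$ is Lebesgue measure in $\mathbb R^3$ or labelled cardinality; $M(Y)=\sum_B\sum_{T\in\mathcal T_B}|Y(T)|$. Setting. Let $0<a\le b\le r$, $0<c_0\le10^{-3}$, $h=c_0a$, $\mathcal Q_h=\{h(k+[0,1)^3):k\in\mathbb Z^3\}$. $\mathcal B$ is a finite nonempty labelled family of parents, each carrying an arbitrarily oriented $a\times b\times r$ rectangular box $B^\sharp$ together with an ordered orthonormal side frame $(e_a(B),e_b(B),e_r(B))$ corresponding to the side lengths (the frame is part of the label). $\mathcal T=\bigsqcup_{B\in\mathcal B}\mathcal T_B$ is a finite indexed family; every $T\in\mathcal T_B$ is contained in $B^\sharp$ and has a measurable shading $Y(T)\subset T$; assume $0<M(Y)<\infty$. Let $N_{\max}=\max_B|\mathcal T_B|$. Joint construction. (1) With $f_B=\sum_{T\in\mathcal T_B}\mathbf 1_{Y(T)}$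 and $X_{B,k}=\{2^k\le f_B<2^{k+1}\}$, choose $k_0\in\{0,\dots,\lceil\log_2N_{\max}\rceil\}$ with $\sum_B\int_{X_{B,k_0}}f_B\ge(1+\lceil\log_2N_{\max}\rceil)^{-1}M(Y)$, and put $Y_0(T)=Y(T)\cap X_{B,k_0}$ for $T\in\mathcal T_B$. (2) Put $\omega_{BQ}=\sum_{T\in\mathcal T_B}|Y_0(T)\cap Q|$, $E^+=\{(B,Q):\omega_{BQ}>0\}$; choose $E_1\subset E^+$, $\omega_0>0$ with $\omega_0\le\omega_e<2\omega_0$ on $E_1$ and $\sum_{E_1}\omega_e\ge\frac{1}{2(1+\lceil\log_2(2|E^+|)\rceil)}\sum_{E^+}\omega_e$. (3) With $d_1(Q)=\#\{B:(B,Q)\in E_1\}$, choose a dyadic $d_0$ for which the cells with $d_0\le d_1(Q)<2d_0$ carry the greatest $E_1$-weight, and put $E_2=\{(B,Q)\in E_1:d_0\le d_1(Q)<2d_0\}$. (4) $Z(B)=\bigcup_{Q:(B,Q)\in E_2}Q$, $Y_1(T)=Y_0(T)\cap Z(B)$ for $T\in\mathcal T_B$. Angles. $TB=\operatorname{span}\{e_b(B),e_r(B)\}$. For planes $P,P'$ with unit normals $n,n'$, $\operatorname{angle}(P,P')=\min\{1,\arccos|\langle n,n'\rangle|\}$. For $q\in(0,1]$, $\operatorname{angle}_q(B,B')=\max\{q,\operatorname{angle}(TB,TB')\}$, and for a nonempty labelled family $\mathcal F$ of parents $M_q(\mathcal F)=\max_{B,B'\in\mathcal F}\operatorname{angle}_q(B,B')$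 (the resolved diameter; a singleton has $M_q=q$). *)

theory Defs
  imports "HOL-Analysis.Analysis"
begin

type_synonym space = "real^3"
type_synonym edge = "nat \<times> space set"

(* Parents are labelled by natural numbers, and a child is labelled by the pair (B, T) of its
   parent's label and a label T in children B; hence the whole family of children is the tagged
   disjoint union of the families children B, and different labels may carry equal sets.
   Concrete labels, rather than a type variable, make the constants asserted by a theorem about
   all settings genuinely absolute. *)
record setting =
  side_a :: real
  side_b :: real
  side_r :: real
  mesh_ratio :: real
  parents :: "nat set"
  corner :: "nat \<Rightarrow> space"
  frame_a :: "nat \<Rightarrow> space"
  frame_b :: "nat \<Rightarrow> space"
  frame_r :: "nat \<Rightarrow> space"
  children :: "nat \<Rightarrow> nat set"
  child_set :: "nat \<Rightarrow> nat \<Rightarrow> space set"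
  shading :: "nat \<Rightarrow> nat \<Rightarrow> space set"

definition parent_box :: "setting \<Rightarrow> nat \<Rightarrow> space set" where
  "parent_box S B =
    {corner S B + s *\<^sub>R frame_a S B + t *\<^sub>R frame_b S B + u *\<^sub>R frame_r S B | s t u.
      0 \<le> s \<and> s \<le> side_a S \<and> 0 \<le> t \<and> t \<le> side_b S \<and> 0 \<le> u \<and> u \<le> side_r S}"

definition orthonormal_frame :: "space \<Rightarrow> space \<Rightarrow> space \<Rightarrow> bool" where
  "orthonormal_frame u v w \<longleftrightarrow>
    norm u = 1 \<and> norm v = 1 \<and> norm w = 1 \<and> orthogonal u v \<and> orthogonal u w \<and> orthogonal v w"

definition shading_mass :: "setting \<Rightarrow> (nat \<Rightarrow> nat \<Rightarrow> space set) \<Rightarrow> real" where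
  "shading_mass S Y = (\<Sum>B\<in>parents S. \<Sum>T\<in>children S B. measure lebesgue (Y B T))"

(* The mass of the shading is automatically finite, since every shading is a measurable subset
   of a bounded box; only its positivity has to be required. *)
definition valid_setting :: "setting \<Rightarrow> bool" where
  "valid_setting S \<longleftrightarrow>
    0 < side_a S \<and> side_a S \<le> side_b S \<and> side_b S \<le> side_r S \<and>
    0 < mesh_ratio S \<and> mesh_ratio S \<le> 1 / 10 ^ 3 \<and>
    finite (parents S) \<and> parents S \<noteq> {} \<and>
    (\<forall>B\<in>parents S. orthonormal_frame (frame_a S B) (frame_b S B) (frame_r S B) \<and>
      finite (children S B) \<and>
      (\<forall>T\<in>children S B. child_set S B T \<subseteq> parent_box S B \<and>
        shading S B T \<subseteq> child_set S B T \<and> shading S B T \<in> sets lebesgue)) \<and>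
    0 < shading_mass S (shading S)"

definition N_max :: "setting \<Rightarrow> nat" where
  "N_max S = Max ((\<lambda>B. card (children S B)) ` parents S)"

definition mesh :: "setting \<Rightarrow> real" where
  "mesh S = mesh_ratio S * side_a S"

definition cell :: "real \<Rightarrow> int^3 \<Rightarrow> space set" where
  "cell h k = {x. \<forall>i. h * of_int (k $ i) \<le> x $ i \<and> x $ i < h * (of_int (k $ i) + 1)}"

definition cells :: "setting \<Rightarrow> space set set" where
  "cells S = range (cell (mesh S))"

definition dyadic :: "nat \<Rightarrow> bool" where
  "dyadic d \<longleftrightarrow> (\<exists>j::nat. d = 2 ^ j)"

definition multiplicity_fun :: "setting \<Rightarrow> nat \<Rightarrow> space \<Rightarrow> real" where
  "multiplicity_fun S B x = (\<Sum>T\<in>children S B. indicator (shading S B T) x)"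

definition level_set :: "setting \<Rightarrow> nat \<Rightarrow> nat \<Rightarrow> space set" where
  "level_set S k B = {x. 2 ^ k \<le> multiplicity_fun S B x \<and> multiplicity_fun S B x < 2 ^ (k + 1)}"

definition Y0 :: "setting \<Rightarrow> nat \<Rightarrow> nat \<Rightarrow> nat \<Rightarrow> space set" where
  "Y0 S k0 B T = shading S B T \<inter> level_set S k0 B"

definition edge_weight :: "setting \<Rightarrow> nat \<Rightarrow> edge \<Rightarrow> real" where
  "edge_weight S k0 = (\<lambda>(B, Q). \<Sum>T\<in>children S B. measure lebesgue (Y0 S k0 B T \<inter> Q))"

definition E_plus :: "setting \<Rightarrow> nat \<Rightarrow> edge set" where
  "E_plus S k0 = {(B, Q). B \<in> parents S \<and> Q \<in> cells S \<and> edge_weight S k0 (B, Q) > 0}"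

definition parents_at :: "edge set \<Rightarrow> space set \<Rightarrow> nat set" where
  "parents_at E Q = {B. (B, Q) \<in> E}"

definition degree_class :: "edge set \<Rightarrow> nat \<Rightarrow> edge set" where
  "degree_class E d =
    {(B, Q) \<in> E. d \<le> card (parents_at E Q) \<and> card (parents_at E Q) < 2 * d}"

definition cell_shading :: "edge set \<Rightarrow> nat \<Rightarrow> space set" where
  "cell_shading E B = \<Union>{Q. (B, Q) \<in> E}"

(* The admissible choices (k0, E1, w0, d0).  They determine E2 = degree_class E1 d0,
   Z = cell_shading E2 and the shading Y1 below. *)
definition joint_construction :: "setting \<Rightarrow> nat \<Rightarrow> edge set \<Rightarrow> real \<Rightarrow> nat \<Rightarrow> bool" where
  "joint_construction S k0 E1 w0 d0 \<longleftrightarrow>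
    int k0 \<le> \<lceil>log 2 (N_max S)\<rceil> \<and>
    (\<Sum>B\<in>parents S. set_lebesgue_integral lebesgue (level_set S k0 B) (multiplicity_fun S B))
      \<ge> shading_mass S (shading S) / (1 + \<lceil>log 2 (N_max S)\<rceil>) \<and>
    E1 \<subseteq> E_plus S k0 \<and> 0 < w0 \<and>
    (\<forall>e\<in>E1. w0 \<le> edge_weight S k0 e \<and> edge_weight S k0 e < 2 * w0) \<and>
    (\<Sum>e\<in>E1. edge_weight S k0 e)
      \<ge> (\<Sum>e\<in>E_plus S k0. edge_weight S k0 e)
          / (2 * (1 + \<lceil>log 2 (2 * real (card (E_plus S k0)))\<rceil>)) \<and>
    dyadic d0 \<and>
    (\<forall>d. dyadic d \<longrightarrow>
      (\<Sum>e\<in>degree_class E1 d. edge_weight S k0 e)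
        \<le> (\<Sum>e\<in>degree_class E1 d0. edge_weight S k0 e))"

definition Y1 :: "setting \<Rightarrow> nat \<Rightarrow> edge set \<Rightarrow> nat \<Rightarrow> nat \<Rightarrow> space set" where
  "Y1 S k0 E2 B T = Y0 S k0 B T \<inter> cell_shading E2 B"

(* A plane through the origin of 3-space has exactly two unit normals, which are opposite, so
   the choice made here does not influence plane_angle. *)
definition unit_normal :: "space set \<Rightarrow> space" where
  "unit_normal P = (SOME n. norm n = 1 \<and> (\<forall>v\<in>P. orthogonal n v))"

definition plane_angle :: "space set \<Rightarrow> space set \<Rightarrow> real" where
  "plane_angle P P' = min 1 (arccos \<bar>unit_normal P \<bullet> unit_normal P'\<bar>)"

definition parent_plane :: "setting \<Rightarrow> nat \<Rightarrow> space set" where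
  "parent_plane S B = span {frame_b S B, frame_r S B}"

definition angle_q :: "setting \<Rightarrow> real \<Rightarrow> nat \<Rightarrow> nat \<Rightarrow> real" where
  "angle_q S q B B' = max q (plane_angle (parent_plane S B) (parent_plane S B'))"

definition resolved_diameter :: "setting \<Rightarrow> real \<Rightarrow> nat set \<Rightarrow> real" where
  "resolved_diameter S q F = Max {angle_q S q B B' | B B'. B \<in> F \<and> B' \<in> F}"

definition alpha :: "setting \<Rightarrow> real" where
  "alpha S = side_a S / side_r S"

definition q_res :: "setting \<Rightarrow> real" where
  "q_res S = side_a S / side_b S"

definition L_0 :: "setting \<Rightarrow> real" where
  "L_0 S = ln (1 / alpha S)"

definition L_plus :: "setting \<Rightarrow> real" where
  "L_plus S = max 1 (L_0 S)"

definition A_ang :: "setting \<Rightarrow> real" where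
  "A_ang S = exp (L_plus S powr (1/2))"

definition B_ang :: "setting \<Rightarrow> real" where
  "B_ang S = exp (L_plus S powr (3/4))"

(* The conversion to nat is harmless: the logarithm is nonnegative in a valid setting. *)
definition K_ang :: "setting \<Rightarrow> nat" where
  "K_ang S = 1 + nat \<lceil>log (B_ang S) (1 / q_res S)\<rceil>"

definition J_theta :: "setting \<Rightarrow> int" where
  "J_theta S = 1 + \<lceil>log 2 (1 / q_res S)\<rceil>"

definition J_d :: "setting \<Rightarrow> int" where
  "J_d S = 1 + \<lceil>log 2 (2 * A_ang S ^ K_ang S)\<rceil>"

end

theory Submission
  imports Defs "HOL-Real_Asymp.Real_Asymp"
begin

text \<open>
  Fix a cell and consider the family of parents joined to it by \<open>E2\<close>. If a subfamily of proportion
  at least \<open>1 / A_ang\<close> has a resolved diameter smaller by a factor \<open>B_ang\<close> or more, replace the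
  family by it and repeat. Resolved diameters lie in \<open>[q_res, 1]\<close>, so this stops after at most
  \<open>log\<^sub>B (1 / q_res)\<close> replacements, with \<open>B = B_ang\<close>. At that point no large subfamily is
  concentrated at a smaller angular scale, and at least the proportion \<open>A_ang ^ (- K_ang)\<close> of the
  family has survived (lemma \<open>stopping_subfamily\<close>).

  The stopped families have various diameters and cardinalities, but there are at most \<open>J_theta\<close>
  dyadic classes of diameters. As the original families have cardinalities within a factor two of
  \<open>d0\<close>, there are at most \<open>J_d\<close> dyadic classes of cardinalities. The cells whose stopped families
  are in the most popular pair of classes carry at least the proportion \<open>1 / (J_theta * J_d)\<close> of the
  surviving edges (lemma \<open>scale_regular_subgraph\<close>). They form the required edge set, with
  \<open>c_ang = A_ang ^ (- K_ang) / (J_theta * J_d)\<close>.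

  This loss is measured in numbers of edges. Since the cells are disjoint translates of one another,
  the sums of volumes of the parent shadings are proportional to these numbers
  (\<open>sum_measure_cell_shading\<close>). The masses of the child shadings are the sums of the edge weights
  (\<open>shading_mass_cell_shading\<close>), which lie in \<open>[w0, 2 * w0)\<close> and are thus proportional to the
  numbers of edges up to a factor two. Finally, \<open>A_ang\<close> and \<open>B_ang\<close> are chosen such that
  \<open>A_ang ^ K_ang\<close> is subpolynomial in \<open>1 / alpha\<close> (\<open>angular_loss_bound\<close>).
\<close>

section \<open>A stopping time in one cell\<close>

text \<open>
  As long as some subfamily violates the conclusion, pass to it. Each passage keeps at least the
  proportion \<open>1 / A\<close> of the members and divides \<open>M\<close> by at least \<open>B > 1\<close>. As \<open>M\<close> is positive, the
  subfamily is a proper one, so on a finite family the descent ends. The number \<open>n\<close> of passages is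
  recorded because the lower bound for \<open>M\<close> on all nonempty families will limit it.
\<close>
lemma stopping_subfamily:
  fixes M :: "'p set \<Rightarrow> real" and A B :: real
  assumes "finite F" "F \<noteq> {}" and B: "B > 1"
    and pos: "\<And>G. finite G \<Longrightarrow> G \<noteq> {} \<Longrightarrow> M G > 0" and A: "A \<ge> 1"
  shows "\<exists>G n. G \<subseteq> F \<and> G \<noteq> {} \<and> real (card F) \<le> A ^ n * real (card G) \<and> B ^ n * M G \<le> M F \<and>
    (\<forall>H\<subseteq>G. real (card H) \<ge> inverse A * real (card G) \<longrightarrow> M H > M G / B)"
  using assms(1,2)
proof (induction "card F" arbitrary: F rule: less_induct)
  case less
  show ?case
  proof (cases "\<forall>H\<subseteq>F. real (card H) \<ge> inverse A * real (card F) \<longrightarrow> M H > M F / B")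
    case True
    then have "F \<subseteq> F \<and> F \<noteq> {} \<and> real (card F) \<le> A ^ 0 * real (card F) \<and> B ^ 0 * M F \<le> M F \<and>
      (\<forall>H\<subseteq>F. real (card H) \<ge> inverse A * real (card F) \<longrightarrow> M H > M F / B)"
      using less.prems by simp
    then show ?thesis by blast
  next
    case False
    then obtain H where H: "H \<subseteq> F" "inverse A * real (card F) \<le> real (card H)" "M H \<le> M F / B"
      by (auto simp: not_less)
    have fin: "finite H" using H(1) less.prems(1) by (rule finite_subset)
    have "0 < inverse A * real (card F)" using A less.prems by (simp add: card_gt_0_iff)
    then have ne: "H \<noteq> {}" using H(2) by auto
    have "M F / B < M F"
      using pos[OF less.prems] B by (simp add: field_simps)
    then have "H \<noteq> F" using H(3) by auto
    then have "card H < card F" using H(1) less.prems(1) by (meson psubsetI psubset_card_mono)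
    from less.hyps[OF this fin ne] obtain G n where G: "G \<subseteq> H" "G \<noteq> {}"
      "real (card H) \<le> A ^ n * real (card G)" "B ^ n * M G \<le> M H"
      "\<forall>H\<subseteq>G. real (card H) \<ge> inverse A * real (card G) \<longrightarrow> M H > M G / B" by blast
    have "real (card F) \<le> A * real (card H)" using H(2) A by (simp add: field_simps)
    also have "\<dots> \<le> A * (A ^ n * real (card G))" using G(3) A by (intro mult_left_mono) auto
    finally have 1: "real (card F) \<le> A ^ Suc n * real (card G)" by (simp add: mult_ac)
    have "B * (B ^ n * M G) \<le> B * M H" using G(4) B by (intro mult_left_mono) auto
    also have "\<dots> \<le> M F" using H(3) B by (simp add: field_simps)
    finally have 2: "B ^ Suc n * M G \<le> M F" by (simp add: mult_ac)
    show ?thesis using G 1 2 H(1) by (intro exI[of _ G] exI[of _ "Suc n"]) auto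
  qed
qed

section \<open>Uniform scale and degree by pigeonholing\<close>

lemma weighted_pigeonhole:
  fixes w :: "'a \<Rightarrow> real"
  assumes "finite S" "finite I" "I \<noteq> {}" "g ` S \<subseteq> I"
  shows "\<exists>i\<in>I. sum w {x \<in> S. g x = i} \<ge> sum w S / real (card I)"
proof (rule ccontr)
  assume "\<not> ?thesis"
  then have "(\<Sum>i\<in>I. sum w {x \<in> S. g x = i}) < (\<Sum>i\<in>I. sum w S / real (card I))"
    using assms by (intro sum_strict_mono) (auto simp: not_le)
  also have "\<dots> = sum w S" using assms by simp
  finally show False using sum.group[OF assms(1,2,4), of w] by simp
qed

lemma dyadic_bracket:
  fixes x :: real
  assumes "1 \<le> x"
  shows "\<exists>i::nat. 2 ^ i \<le> x \<and> x < 2 * 2 ^ i"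
proof -
  define i where "i = nat \<lfloor>log 2 x\<rfloor>"
  have "0 \<le> log 2 x" using assms by simp
  then have "real i \<le> log 2 x" "log 2 x < real i + 1" by (auto simp: i_def)
  then have "2 powr real i \<le> x" "x < 2 powr (real i + 1)"
    using assms by (auto simp: le_log_iff log_less_iff)
  then show ?thesis by (intro exI[of _ i]) (simp add: powr_add powr_realpow)
qed

text \<open>
  Here \<open>E\<close> is a bipartite graph whose nonempty fibres over the second component have comparable
  sizes, and \<open>M\<close> takes values in \<open>[q, 1]\<close>. The stopping time in a fibre then makes at most
  \<open>log\<^sub>B (1 / q) \<le> K\<close> passages, hence costs at most a factor \<open>A ^ K\<close>. Both \<open>M\<close> and the size of the
  stopped fibre are confined to few dyadic classes: the former because it lies in \<open>[q, 1]\<close>, the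
  latter because it lies between \<open>A ^ (- K) * 2 ^ m\<close> and \<open>2 ^ (m + 1)\<close>. The pair of classes with
  the most edges is the one to keep. No edge is removed from a kept fibre, so the pigeonholing
  does not affect the stopping property.
\<close>
lemma scale_regular_subgraph:
  fixes E :: "('p \<times> 'q) set" and M :: "'p set \<Rightarrow> real" and A B q :: real and m :: nat
  defines "K \<equiv> 1 + nat \<lceil>log B (1 / q)\<rceil>"
  assumes fin: "finite E"
    and deg: "\<And>Q. {p. (p, Q) \<in> E} \<noteq> {} \<Longrightarrow>
      2 ^ m \<le> card {p. (p, Q) \<in> E} \<and> card {p. (p, Q) \<in> E} < 2 * 2 ^ m"
    and q: "0 < q" "q \<le> 1" and A: "1 \<le> A" and B: "1 < B"
    and M: "\<And>G. finite G \<Longrightarrow> G \<noteq> {} \<Longrightarrow> q \<le> M G \<and> M G \<le> 1"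
  shows "\<exists>E' (i::nat) \<theta>. E' \<subseteq> E \<and> \<theta> \<in> {q..1} \<and>
    (\<forall>Q. {p. (p, Q) \<in> E'} \<noteq> {} \<longrightarrow>
      card {p. (p, Q) \<in> E'} \<in> {2 ^ i..<2 * 2 ^ i} \<and>
      M {p. (p, Q) \<in> E'} \<in> {\<theta>..<2 * \<theta>} \<and>
      (\<forall>H\<subseteq>{p. (p, Q) \<in> E'}. real (card H) \<ge> inverse A * real (card {p. (p, Q) \<in> E'})
        \<longrightarrow> M H > \<theta> / B)) \<and>
    real (card E') \<ge> inverse (A ^ K) /
      ((1 + \<lceil>log 2 (1 / q)\<rceil>) * (1 + \<lceil>log 2 (2 * A ^ K)\<rceil>)) * real (card E)"
proof -
  define F where "F Q = {p. (p, Q) \<in> E}" for Q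
  define S where "S = snd ` E"
  have finS: "finite S" using fin by (simp add: S_def)
  have finF: "finite (F Q)" for Q
    by (rule finite_subset[of _ "fst ` E"]) (auto simp: F_def fin image_iff, force)
  have neF: "F Q \<noteq> {}" if "Q \<in> S" for Q using that by (auto simp: S_def F_def)
  have Mpos: "M G > 0" if "finite G" "G \<noteq> {}" for G using M[OF that] q by linarith
  have logq: "0 \<le> log 2 (1 / q)" using q by simp
  have AK: "1 \<le> A ^ K" using A by simp
  have logA: "0 \<le> log 2 (2 * A ^ K)" using AK by simp
  have "\<exists>G. G \<subseteq> F Q \<and> G \<noteq> {} \<and> real (card (F Q)) \<le> A ^ K * real (card G) \<and>
    (\<forall>H\<subseteq>G. real (card H) \<ge> inverse A * real (card G) \<longrightarrow> M H > M G / B)" if Q: "Q \<in> S" for Q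
  proof -
    have "\<exists>G n. G \<subseteq> F Q \<and> G \<noteq> {} \<and> real (card (F Q)) \<le> A ^ n * real (card G) \<and>
        B ^ n * M G \<le> M (F Q) \<and>
        (\<forall>H\<subseteq>G. real (card H) \<ge> inverse A * real (card G) \<longrightarrow> M H > M G / B)"
      by (rule stopping_subfamily[OF finF neF[OF Q] B Mpos A])
    then obtain G n where G: "G \<subseteq> F Q" "G \<noteq> {}" "real (card (F Q)) \<le> A ^ n * real (card G)"
      "B ^ n * M G \<le> M (F Q)"
      "\<forall>H\<subseteq>G. real (card H) \<ge> inverse A * real (card G) \<longrightarrow> M H > M G / B"
      by (elim exE conjE) (rule that)
    have "B ^ n * q \<le> B ^ n * M G"
      using M[OF finite_subset[OF G(1) finF] G(2)] B by (intro mult_left_mono) auto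
    also have "\<dots> \<le> 1" using G(4) M[OF finF neF[OF Q]] by linarith
    finally have "B powr real n \<le> 1 / q" using q B by (simp add: field_simps powr_realpow)
    then have "real n \<le> log B (1 / q)" using B q by (subst le_log_iff) auto
    then have "n \<le> K" unfolding K_def by linarith
    then have "A ^ n * real (card G) \<le> A ^ K * real (card G)"
      using A by (intro mult_right_mono power_increasing) auto
    then show ?thesis using G by (intro exI[of _ G]) auto
  qed
  then obtain G where G: "\<And>Q. Q \<in> S \<Longrightarrow> G Q \<subseteq> F Q" "\<And>Q. Q \<in> S \<Longrightarrow> G Q \<noteq> {}"
      "\<And>Q. Q \<in> S \<Longrightarrow> real (card (F Q)) \<le> A ^ K * real (card (G Q))"
      "\<And>Q H. Q \<in> S \<Longrightarrow> H \<subseteq> G Q \<Longrightarrow> real (card H) \<ge> inverse A * real (card (G Q))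
        \<Longrightarrow> M H > M (G Q) / B"
    by metis
  have finG: "finite (G Q)" if "Q \<in> S" for Q using G(1)[OF that] finF by (rule finite_subset)
  have "\<exists>j::nat. 2 ^ j \<le> M (G Q) / q \<and> M (G Q) / q < 2 * 2 ^ j" if "Q \<in> S" for Q
    using M[OF finG[OF that] G(2)[OF that]] q by (intro dyadic_bracket) (simp add: field_simps)
  then obtain j where j: "\<And>Q. Q \<in> S \<Longrightarrow> 2 ^ j Q \<le> M (G Q) / q \<and> M (G Q) / q < 2 * 2 ^ j Q"
    by metis
  have "\<exists>i::nat. 2 ^ i \<le> real (card (G Q)) \<and> real (card (G Q)) < 2 * 2 ^ i" if "Q \<in> S" for Q
    using finG[OF that] G(2)[OF that] by (intro dyadic_bracket) (simp add: Suc_leI card_gt_0_iff)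
  then obtain i where i: "\<And>Q. Q \<in> S \<Longrightarrow> 2 ^ i Q \<le> real (card (G Q)) \<and> real (card (G Q)) < 2 * 2 ^ i Q"
    by metis
  \<comment> \<open>The admissible dyadic scales, and the admissible dyadic degrees: the truncated difference
    only removes negative exponents.\<close>
  define J where "J = {..nat \<lceil>log 2 (1 / q)\<rceil>}"
  define I where "I = {m - nat \<lceil>log 2 (2 * A ^ K)\<rceil>..m}"
  have jJ: "q * 2 ^ j Q \<le> 1" "j Q \<in> J" if "Q \<in> S" for Q
  proof -
    have "q * 2 ^ j Q \<le> M (G Q)" using j[OF that] q by (simp add: field_simps)
    also have "\<dots> \<le> 1" using M[OF finG[OF that] G(2)[OF that]] by simp
    finally show *: "q * 2 ^ j Q \<le> 1" .
    then have "2 powr real (j Q) \<le> 1 / q" using q by (simp add: field_simps powr_realpow)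
    then have "real (j Q) \<le> log 2 (1 / q)" using q by (subst le_log_iff) auto
    then show "j Q \<in> J" unfolding J_def by simp linarith
  qed
  have iI: "i Q \<in> I" if Q: "Q \<in> S" for Q
  proof -
    have d: "2 ^ m \<le> card (F Q)" "card (F Q) < 2 * 2 ^ m"
      using deg neF[OF Q] by (auto simp: F_def)
    have "card (G Q) \<le> card (F Q)" using G(1)[OF Q] finF by (intro card_mono)
    then have "card (G Q) < 2 ^ Suc m" using d by simp
    then have "real (card (G Q)) < 2 ^ Suc m" by (metis of_nat_less_iff of_nat_numeral of_nat_power)
    then have "(2::real) ^ i Q < 2 ^ Suc m" using i[OF Q] by linarith
    then have 1: "i Q \<le> m" by (simp add: less_Suc_eq_le[symmetric] del: power_Suc)
    have "(2::real) ^ m \<le> real (card (F Q))" using d(1) by (metis of_nat_le_iff of_nat_numeral of_nat_power)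
    also have "\<dots> \<le> A ^ K * (2 * 2 ^ i Q)"
      using G(3)[OF Q] i[OF Q] AK by (meson less_eq_real_def mult_left_mono order_trans zero_le_one)
    finally have "(2::real) powr (real m - real (i Q)) \<le> 2 * A ^ K"
      by (simp add: powr_diff powr_realpow field_simps)
    then have "real m - real (i Q) \<le> log 2 (2 * A ^ K)" using AK by (subst le_log_iff) auto
    then have "m - nat \<lceil>log 2 (2 * A ^ K)\<rceil> \<le> i Q" by linarith
    with 1 show ?thesis by (simp add: I_def)
  qed
  have JI: "finite (J \<times> I)" "J \<times> I \<noteq> {}" by (auto simp: J_def I_def)
  have "(\<lambda>Q. (j Q, i Q)) ` S \<subseteq> J \<times> I" using jJ(2) iI by blast
  from weighted_pigeonhole[OF finS JI this, of "\<lambda>Q. real (card (G Q))"]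
  obtain ij where ij: "ij \<in> J \<times> I"
    "(\<Sum>Q | Q \<in> S \<and> (j Q, i Q) = ij. real (card (G Q))) \<ge>
      (\<Sum>Q\<in>S. real (card (G Q))) / real (card (J \<times> I))"
    by blast
  obtain j0 i0 where ij0: "ij = (j0, i0)" by (cases ij)
  define S' where "S' = {Q \<in> S. j Q = j0 \<and> i Q = i0}"
  define E' where "E' = {(p, Q). Q \<in> S' \<and> p \<in> G Q}"
  \<comment> \<open>If no fibre is kept, \<open>q * 2 ^ j0\<close> may exceed \<open>1\<close>, as \<open>J\<close> comes from a rounded logarithm.\<close>
  define \<theta> where "\<theta> = (if S' = {} then q else q * 2 ^ j0)"
  have S'S: "S' \<subseteq> S" by (auto simp: S'_def)
  have E'E: "E' \<subseteq> E" using G(1) by (force simp: E'_def S'_def F_def)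
  have \<theta>: "\<theta> \<in> {q..1}"
    using jJ(1) q one_le_power[of "2::real" j0] by (auto simp: \<theta>_def S'_def)
  have sumcard: "card X = (\<Sum>Q\<in>U. card (V Q))"
    if "X = {(p, Q). Q \<in> U \<and> p \<in> V Q}" "finite U" "\<And>Q. Q \<in> U \<Longrightarrow> finite (V Q)"
    for X :: "('p \<times> 'q) set" and U V
  proof -
    have "X = prod.swap ` (SIGMA Q:U. V Q)" using that(1) by force
    then show ?thesis using that by (simp add: card_image card_SigmaI)
  qed
  have cE: "card E = (\<Sum>Q\<in>S. card (F Q))"
    using finS finF by (intro sumcard) (force simp: S_def F_def)+
  have cE': "card E' = (\<Sum>Q\<in>S'. card (G Q))"
    using finS finG S'S by (intro sumcard) (auto simp: E'_def intro: finite_subset)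
  have cJI: "real (card (J \<times> I)) \<le> (1 + \<lceil>log 2 (1 / q)\<rceil>) * (1 + \<lceil>log 2 (2 * A ^ K)\<rceil>)"
  proof -
    have "real (card J) \<le> 1 + \<lceil>log 2 (1 / q)\<rceil>" using logq by (simp add: J_def)
    moreover have "real (card I) \<le> 1 + \<lceil>log 2 (2 * A ^ K)\<rceil>" using logA unfolding I_def by simp linarith
    ultimately show ?thesis by (simp add: card_cartesian_product mult_mono)
  qed
  have cpos: "real (card (J \<times> I)) > 0" using JI unfolding of_nat_0_less_iff card_gt_0_iff by blast
  have "real (card E) \<le> (\<Sum>Q\<in>S. A ^ K * real (card (G Q)))"
    unfolding cE of_nat_sum using G(3) by (intro sum_mono)
  then have "inverse (A ^ K) * real (card E) \<le> (\<Sum>Q\<in>S. real (card (G Q)))"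
    using AK by (simp add: sum_distrib_left[symmetric] field_simps)
  then have "inverse (A ^ K) * real (card E) / ((1 + \<lceil>log 2 (1 / q)\<rceil>) * (1 + \<lceil>log 2 (2 * A ^ K)\<rceil>))
      \<le> (\<Sum>Q\<in>S. real (card (G Q))) / real (card (J \<times> I))"
    using AK cJI cpos by (intro frac_le) (auto intro: sum_nonneg)
  also have "\<dots> \<le> real (card E')"
    using ij(2) unfolding ij0 cE' S'_def by simp
  finally have card: "real (card E') \<ge> inverse (A ^ K) /
      ((1 + \<lceil>log 2 (1 / q)\<rceil>) * (1 + \<lceil>log 2 (2 * A ^ K)\<rceil>)) * real (card E)" by simp
  have fibre: "{p. (p, Q) \<in> E'} = (if Q \<in> S' then G Q else {})" for Q by (auto simp: E'_def)
  have main: "card (G Q) \<in> {2 ^ i0..<2 * 2 ^ i0} \<and> M (G Q) \<in> {\<theta>..<2 * \<theta>} \<and>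
     (\<forall>H\<subseteq>G Q. real (card H) \<ge> inverse A * real (card (G Q)) \<longrightarrow> M H > \<theta> / B)" if Q: "Q \<in> S'" for Q
  proof -
    have QS: "Q \<in> S" "j Q = j0" "i Q = i0" using Q by (auto simp: S'_def)
    have \<theta>': "\<theta> = q * 2 ^ j0" using Q by (auto simp: \<theta>_def)
    have "real (2 ^ i0) \<le> real (card (G Q))" "real (card (G Q)) < real (2 * 2 ^ i0)"
      using i[OF QS(1)] QS by simp_all
    then have 1: "card (G Q) \<in> {2 ^ i0..<2 * 2 ^ i0}" unfolding of_nat_le_iff of_nat_less_iff by simp
    have 2: "M (G Q) \<in> {\<theta>..<2 * \<theta>}" using j[OF QS(1)] QS q by (simp add: \<theta>' field_simps)
    have "\<theta> / B \<le> M (G Q) / B" using 2 B by (simp add: divide_right_mono)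
    with 1 2 show ?thesis using G(4)[OF QS(1)] by (meson le_less_trans)
  qed
  show ?thesis
    using E'E \<theta> card main unfolding fibre
    by (intro exI[of _ E'] exI[of _ i0] exI[of _ \<theta>]) (auto simp: fibre)
qed

section \<open>Geometry of the mesh\<close>

lemma cell_index:
  assumes "h > 0" "x \<in> cell h k"
  shows "k $ i = \<lfloor>x $ i / h\<rfloor>"
  using assms by (auto simp: cell_def floor_eq_iff field_simps intro!: sym[OF floor_unique])

lemma cells_disjoint:
  assumes "h > 0" "P \<in> range (cell h)" "Q \<in> range (cell h)" "P \<noteq> Q"
  shows "P \<inter> Q = {}"
proof (rule ccontr)
  assume "P \<inter> Q \<noteq> {}"
  then obtain x k k' where "x \<in> cell h k" "x \<in> cell h k'" "P = cell h k" "Q = cell h k'"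
    using assms by auto
  moreover from this have "k = k'" using cell_index[OF assms(1)] by (simp add: vec_eq_iff)
  ultimately show False using assms by simp
qed

text \<open>
  All that matters about the volume of a cell is that it does not depend on the cell, so that
  volumes of cellular shadings are proportional to numbers of edges.
\<close>
lemma cell_translate: "cell h k = (+) (\<chi> i. h * of_int (k $ i)) ` cell h 0"
proof (intro set_eqI iffI)
  fix x assume "x \<in> cell h k"
  then have "x - (\<chi> i. h * of_int (k $ i)) \<in> cell h 0"
    by (auto simp: cell_def algebra_simps)
  then show "x \<in> (+) (\<chi> i. h * of_int (k $ i)) ` cell h 0"
    by (rule rev_image_eqI) simp
qed (auto simp: cell_def algebra_simps)

lemma cell_lmeasurable: "cell h k \<in> lmeasurable"
proof (rule measurable_convex)
  have eq: "cell h k = (\<Inter>i. {x. x $ i \<ge> h * of_int (k $ i)} \<inter> {x. x $ i < h * (of_int (k $ i) + 1)})"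
    by (auto simp: cell_def)
  have "convex {x :: space. x $ i \<ge> c}" "convex {x :: space. x $ i < c}" for i c
  proof -
    have "{x :: space. x $ i \<ge> c} = {x. axis i 1 \<bullet> x \<ge> c}" "{x :: space. x $ i < c} = {x. axis i 1 \<bullet> x < c}"
      by (simp_all add: inner_axis')
    then show "convex {x :: space. x $ i \<ge> c}" "convex {x :: space. x $ i < c}"
      by (simp_all only: convex_halfspace_ge convex_halfspace_lt)
  qed
  then show "convex (cell h k)" unfolding eq by (intro convex_INT convex_Int ballI) auto
  have "cell h k \<subseteq> cbox (\<chi> i. h * of_int (k $ i)) (\<chi> i. h * (of_int (k $ i) + 1))"
    by (auto simp: cell_def mem_box_cart less_imp_le)
  then show "bounded (cell h k)" using bounded_cbox bounded_subset by blast
qed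

lemma finite_cells_meeting_bounded:
  assumes h: "h > 0" and "bounded X"
  shows "finite {Q \<in> range (cell h). Q \<inter> X \<noteq> {}}"
proof -
  obtain R where R: "\<And>x. x \<in> X \<Longrightarrow> norm x \<le> R" using assms(2) by (auto simp: bounded_iff)
  define N where "N = \<lceil>R / h\<rceil> + 1"
  have sub: "k \<in> {k. \<forall>i. k $ i \<in> {- N..N}}" if "cell h k \<inter> X \<noteq> {}" for k
  proof -
    from that obtain x where x: "x \<in> cell h k" "x \<in> X" by auto
    have "k $ i \<in> {- N..N}" for i
    proof -
      have "\<bar>x $ i\<bar> \<le> R" using component_le_norm_cart[of x i] R[OF x(2)] by linarith
      then have "\<bar>x $ i / h\<bar> \<le> R / h" using h by (simp add: abs_divide divide_right_mono)
      then show ?thesis unfolding cell_index[OF h x(1)] N_def atLeastAtMost_iff by linarith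
    qed
    then show ?thesis by simp
  qed
  have "finite {k :: int^3. \<forall>i. k $ i \<in> {- N..N}}"
  proof (rule finite_surj[where f = "\<lambda>f. (\<chi> i. f i)"])
    show "finite (Pi\<^sub>E (UNIV :: 3 set) (\<lambda>_. {- N..N}))" by (intro finite_PiE) auto
    show "{k :: int^3. \<forall>i. k $ i \<in> {- N..N}} \<subseteq> (\<lambda>f. \<chi> i. f i) ` Pi\<^sub>E UNIV (\<lambda>_. {- N..N})"
      by (rule subsetI, rule_tac x = "\<lambda>i. x $ i" in image_eqI) (auto simp: vec_eq_iff)
  qed
  then have "finite {k. cell h k \<inter> X \<noteq> {}}" by (rule rev_finite_subset) (use sub in blast)
  then have "finite (cell h ` {k. cell h k \<inter> X \<noteq> {}})" by (rule finite_imageI)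
  moreover have "{Q \<in> range (cell h). Q \<inter> X \<noteq> {}} = cell h ` {k. cell h k \<inter> X \<noteq> {}}" by auto
  ultimately show ?thesis by simp
qed

lemma measure_Int_cell_shading:
  assumes h: "h > 0" and fin: "finite E" and E: "snd ` E \<subseteq> range (cell h)"
    and P: "P \<in> sets lebesgue"
  shows "measure lebesgue (P \<inter> cell_shading E B) = (\<Sum>Q | (B, Q) \<in> E. measure lebesgue (P \<inter> Q))"
proof -
  let ?N = "{Q. (B, Q) \<in> E}"
  have N: "?N \<subseteq> range (cell h)" using E by force
  have finN: "finite ?N" by (rule finite_subset[OF _ finite_imageI[OF fin, of snd]]) force
  have lm: "P \<inter> Q \<in> lmeasurable" if "Q \<in> ?N" for Q
    using that N cell_lmeasurable P by (metis (no_types, lifting) Int_commute fmeasurable_Int_fmeasurable imageE subsetD)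
  have "P \<inter> cell_shading E B = (\<Union>Q\<in>?N. P \<inter> Q)" by (auto simp: cell_shading_def)
  moreover have "measure lebesgue (\<Union>Q\<in>?N. P \<inter> Q) = (\<Sum>Q\<in>?N. measure lebesgue (P \<inter> Q))"
  proof (rule measure_finite_Union)
    show "disjoint_family_on (\<lambda>Q. P \<inter> Q) ?N"
      using cells_disjoint[OF h] N unfolding disjoint_family_on_def by (metis (no_types, lifting) Int_assoc Int_left_commute inf_bot_right subsetD)
    show "emeasure lebesgue (P \<inter> Q) \<noteq> \<infinity>" if "Q \<in> ?N" for Q
      using fmeasurableD2[OF lm[OF that]] by simp
    show "(\<lambda>Q. P \<inter> Q) ` ?N \<subseteq> sets lebesgue" using lm fmeasurableD by blast
  qed (rule finN)
  ultimately show ?thesis by simp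
qed

lemma sum_fibres:
  assumes "finite E" "finite U" "fst ` E \<subseteq> U"
  shows "(\<Sum>B\<in>U. \<Sum>Q | (B, Q) \<in> E. f (B, Q)) = sum f E"
proof -
  have "finite {Q. (B, Q) \<in> E}" for B
    by (rule finite_subset[OF _ finite_imageI[OF assms(1), of snd]]) force
  then have "(\<Sum>B\<in>U. \<Sum>Q | (B, Q) \<in> E. f (B, Q)) = sum f (SIGMA B:U. {Q. (B, Q) \<in> E})"
    using assms(2) by (subst sum.Sigma) auto
  also have "(SIGMA B:U. {Q. (B, Q) \<in> E}) = E" using assms(3) by force
  finally show ?thesis .
qed

lemma sum_measure_cell_shading:
  assumes h: "h > 0" and fin: "finite E" "finite U" and E: "E \<subseteq> U \<times> range (cell h)"
  shows "(\<Sum>B\<in>U. measure lebesgue (cell_shading E B)) = measure lebesgue (cell h 0) * real (card E)"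
proof -
  have sn: "snd ` E \<subseteq> range (cell h)" "fst ` E \<subseteq> U" using E by force+
  have "measure lebesgue (cell_shading E B) = (\<Sum>Q | (B, Q) \<in> E. measure lebesgue Q)" for B
    using measure_Int_cell_shading[OF h fin(1) sn(1), of UNIV B] by simp
  then have "(\<Sum>B\<in>U. measure lebesgue (cell_shading E B)) = (\<Sum>e\<in>E. measure lebesgue (snd e))"
    using sum_fibres[OF fin sn(2), of "\<lambda>e. measure lebesgue (snd e)"] by simp
  also have "\<dots> = (\<Sum>e\<in>E. measure lebesgue (cell h 0))"
  proof (rule sum.cong)
    fix e assume "e \<in> E"
    then obtain k where "snd e = cell h k" using sn by force
    then show "measure lebesgue (snd e) = measure lebesgue (cell h 0)"
      by (metis cell_translate measure_translation)
  qed simp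
  finally show ?thesis by (simp add: mult.commute)
qed

section \<open>Edge weights of a valid setting\<close>

lemma Y0_lebesgue:
  assumes "valid_setting S" "B \<in> parents S" "T \<in> children S B"
  shows "Y0 S k B T \<in> sets lebesgue"
proof -
  have sh: "shading S B T \<in> sets lebesgue" if "T \<in> children S B" for T
    using assms that by (auto simp: valid_setting_def)
  have m: "multiplicity_fun S B \<in> borel_measurable lebesgue"
    unfolding multiplicity_fun_def using sh by (intro borel_measurable_sum borel_measurable_indicator)
  have "level_set S k B = multiplicity_fun S B -` {2 ^ k..<2 ^ (k + 1)} \<inter> space lebesgue"
    by (auto simp: level_set_def)
  also have "\<dots> \<in> sets lebesgue" using m by (rule measurable_sets) auto
  finally show ?thesis unfolding Y0_def using sh[OF assms(3)] by blast
qed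

lemma mesh_pos: "valid_setting S \<Longrightarrow> mesh S > 0"
  by (simp add: valid_setting_def mesh_def)

lemma bounded_parent_box: "bounded (parent_box S B)"
proof -
  let ?f = "\<lambda>p. corner S B + fst p *\<^sub>R frame_a S B + fst (snd p) *\<^sub>R frame_b S B + snd (snd p) *\<^sub>R frame_r S B"
  have "parent_box S B = ?f ` ({0..side_a S} \<times> {0..side_b S} \<times> {0..side_r S})"
    unfolding parent_box_def by (rule set_eqI) (simp add: image_iff Bex_def, blast)
  moreover have "compact ({0..side_a S} \<times> {0..side_b S} \<times> {0..side_r S})"
    by (intro compact_Times compact_Icc)
  then have "compact (?f ` ({0..side_a S} \<times> {0..side_b S} \<times> {0..side_r S}))"
    by (intro compact_continuous_image continuous_intros)
  ultimately show ?thesis using compact_imp_bounded by metis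
qed

text \<open>
  An edge of positive weight has a cell meeting the bounded box of its parent.
\<close>
lemma finite_E_plus:
  assumes "valid_setting S"
  shows "finite (E_plus S k)"
proof -
  let ?X = "\<Union>B\<in>parents S. parent_box S B"
  have "bounded ?X" using assms bounded_parent_box by (intro bounded_UN) (auto simp: valid_setting_def)
  then have "finite {Q \<in> cells S. Q \<inter> ?X \<noteq> {}}"
    unfolding cells_def by (rule finite_cells_meeting_bounded[OF mesh_pos[OF assms]])
  moreover have "finite (parents S)" using assms by (simp add: valid_setting_def)
  ultimately have fin: "finite (parents S \<times> {Q \<in> cells S. Q \<inter> ?X \<noteq> {}})"
    by (intro finite_cartesian_product)
  have "E_plus S k \<subseteq> parents S \<times> {Q \<in> cells S. Q \<inter> ?X \<noteq> {}}"
  proof (rule subrelI)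
    fix B Q assume "(B, Q) \<in> E_plus S k"
    then have *: "B \<in> parents S" "Q \<in> cells S" "edge_weight S k (B, Q) > 0" by (auto simp: E_plus_def)
    then have "(\<Sum>T\<in>children S B. measure lebesgue (Y0 S k B T \<inter> Q)) \<noteq> 0" by (simp add: edge_weight_def)
    then obtain T where T: "T \<in> children S B" "measure lebesgue (Y0 S k B T \<inter> Q) \<noteq> 0"
      by (meson sum.neutral)
    then have "Y0 S k B T \<inter> Q \<noteq> {}" by (metis measure_empty)
    moreover have "Y0 S k B T \<subseteq> parent_box S B"
      using assms * T(1) by (fastforce simp: valid_setting_def Y0_def)
    ultimately have "Q \<inter> ?X \<noteq> {}" using *(1) by blast
    then show "(B, Q) \<in> parents S \<times> {Q \<in> cells S. Q \<inter> ?X \<noteq> {}}" using * by simp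
  qed
  then show ?thesis using fin by (rule finite_subset)
qed

text \<open>
  The weights of the edges are masses in disjoint cells. This turns the comparison of masses
  of child shadings into one of sums over edges.
\<close>
lemma shading_mass_cell_shading:
  assumes S: "valid_setting S" and E: "E \<subseteq> E_plus S k"
  shows "shading_mass S (\<lambda>B T. Y0 S k B T \<inter> cell_shading E B) = sum (edge_weight S k) E"
proof -
  have fin: "finite E" using E finite_E_plus[OF S] by (rule finite_subset)
  have sn: "snd ` E \<subseteq> range (cell (mesh S))" "fst ` E \<subseteq> parents S"
    using E by (auto simp: E_plus_def cells_def)
  have "(\<Sum>T\<in>children S B. measure lebesgue (Y0 S k B T \<inter> cell_shading E B)) =
     (\<Sum>Q | (B, Q) \<in> E. edge_weight S k (B, Q))" if "B \<in> parents S" for B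
  proof -
    have "(\<Sum>T\<in>children S B. measure lebesgue (Y0 S k B T \<inter> cell_shading E B)) =
      (\<Sum>T\<in>children S B. \<Sum>Q | (B, Q) \<in> E. measure lebesgue (Y0 S k B T \<inter> Q))"
      using measure_Int_cell_shading[OF mesh_pos[OF S] fin sn(1)] Y0_lebesgue[OF S that] by simp
    then show ?thesis by (simp add: edge_weight_def sum.swap[of _ _ "children S B"])
  qed
  then show ?thesis
    unfolding shading_mass_def using sum_fibres[OF fin _ sn(2)] S by (simp add: valid_setting_def)
qed

lemma resolved_diameter_bounds:
  assumes "q \<le> 1" "finite F" "F \<noteq> {}"
  shows "q \<le> resolved_diameter S q F \<and> resolved_diameter S q F \<le> 1"
proof -
  let ?V = "{angle_q S q B B' | B B'. B \<in> F \<and> B' \<in> F}"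
  have V: "?V = (\<lambda>(B, B'). angle_q S q B B') ` (F \<times> F)" by auto
  have fin: "finite ?V" and ne: "?V \<noteq> {}" unfolding V using assms by auto
  have *: "q \<le> v \<and> v \<le> 1" if v: "v \<in> ?V" for v
  proof -
    obtain B B' where "v = angle_q S q B B'" using v by blast
    then show ?thesis using assms(1) by (simp add: angle_q_def plane_angle_def)
  qed
  then show ?thesis unfolding resolved_diameter_def using Max_in[OF fin ne] by blast
qed

section \<open>The size of the loss\<close>

text \<open>
  The exponents are balanced by \<open>L powr (1/2) * L powr (1/4) = L powr (3/4)\<close>: since \<open>K\<close> is at most
  \<open>2 + L / L powr (3/4)\<close>, the stopping loss \<open>exp (K * L powr (1/2))\<close> is at most
  \<open>exp (L powr (3/4) + 2 * L powr (1/2))\<close>. Its logarithm is at most \<open>3 * L\<close>, so each of the two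
  pigeonholings loses only a factor linear in \<open>L\<close>.
\<close>
lemma angular_loss_bound:
  fixes L q :: real
  assumes L: "1 \<le> L" and q: "0 < q" "q \<le> 1" "ln (1 / q) \<le> L"
  defines "K \<equiv> 1 + nat \<lceil>log (exp (L powr (3/4))) (1 / q)\<rceil>"
  shows "exp (L powr (1/2)) ^ K * ((1 + \<lceil>log 2 (1 / q)\<rceil>) * (1 + \<lceil>log 2 (2 * exp (L powr (1/2)) ^ K)\<rceil>))
    \<le> 12 * (1 + L)\<^sup>2 * exp (L powr (3/4) + 2 * L powr (1/2))"
proof -
  define s where "s = L powr (1/2)"
  define t where "t = L powr (3/4)"
  have s: "1 \<le> s" "s \<le> L" and t: "1 \<le> t" "t \<le> L"
    using L powr_mono[of "1/2" 1 L] powr_mono[of "3/4" 1 L] by (auto simp: s_def t_def ge_one_powr_ge_zero)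
  have "L powr (1/2) * L powr 1 = L powr (3/4) * L powr (3/4)" unfolding powr_add[symmetric] by simp
  then have tt: "s * L = t * t" using L by (simp add: s_def t_def)
  have l0: "0 \<le> ln (1 / q)" using q by simp
  have "0 \<le> ln (1 / q) / t" using l0 t by simp
  then have "real K \<le> 2 + ln (1 / q) / t" unfolding K_def log_def t_def[symmetric] by simp linarith
  also have "\<dots> \<le> 2 + L / t" using q t by (simp add: divide_right_mono)
  finally have "s * real K \<le> s * (2 + L / t)" using s by (intro mult_left_mono) auto
  also have "\<dots> = 2 * s + t" using tt t by (simp add: field_simps)
  finally have sK: "s * real K \<le> t + 2 * s" by simp
  have AK: "exp s ^ K = exp (s * real K)" by (simp add: exp_of_nat2_mult)
  have ln2: "1 / 2 \<le> ln (2::real)" using ln2_ge_two_thirds by simp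
  have dbl: "x / ln 2 \<le> 2 * x" if "0 \<le> x" for x :: real
  proof -
    have "x * (1/2) \<le> x * ln 2" using ln2 that by (rule mult_left_mono)
    then show ?thesis using ln2 by (simp add: field_simps)
  qed
  have 0: "0 \<le> log 2 (1 / q)" using q by simp
  have ceil: "real_of_int (1 + \<lceil>y\<rceil>) \<le> z + 2" if "y \<le> z" for y z :: real
    by simp (rule order_trans[OF of_int_ceiling_le_add_one], use that in simp)
  have "log 2 (1 / q) \<le> 2 * L" using dbl[OF l0] q by (simp add: log_def)
  then have J1: "real_of_int (1 + \<lceil>log 2 (1 / q)\<rceil>) \<le> 2 * (1 + L)"
    using ceil by fastforce
  have logA: "log 2 (2 * exp s ^ K) = 1 + s * real K / ln 2" by (simp add: log_mult AK log_def[of 2 "exp _"])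
  also have "\<dots> \<le> 1 + 2 * (3 * L)" using dbl[of "s * real K"] sK s t by simp
  finally have J2: "real_of_int (1 + \<lceil>log 2 (2 * exp s ^ K)\<rceil>) \<le> 6 * (1 + L)"
    using ceil L by fastforce
  have "0 \<le> log 2 (2 * exp s ^ K)" using s unfolding logA by simp
  then have J0: "0 \<le> real_of_int (1 + \<lceil>log 2 (2 * exp s ^ K)\<rceil>)" by linarith
  have "real_of_int (1 + \<lceil>log 2 (1 / q)\<rceil>) * real_of_int (1 + \<lceil>log 2 (2 * exp s ^ K)\<rceil>)
      \<le> (2 * (1 + L)) * (6 * (1 + L))"
    using J1 J2 J0 L by (intro mult_mono) auto
  moreover have "0 \<le> real_of_int (1 + \<lceil>log 2 (1 / q)\<rceil>)" using 0 by linarith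
  note P0 = mult_nonneg_nonneg[OF this J0]
  ultimately have "exp s ^ K * (real_of_int (1 + \<lceil>log 2 (1 / q)\<rceil>) * real_of_int (1 + \<lceil>log 2 (2 * exp s ^ K)\<rceil>))
     \<le> exp (t + 2 * s) * ((2 * (1 + L)) * (6 * (1 + L)))"
    unfolding AK by - (rule mult_mono, use sK P0[unfolded AK] in auto)
  also have "\<dots> = 12 * (1 + L)\<^sup>2 * exp (t + 2 * s)" by (simp add: power2_eq_square algebra_simps)
  finally show ?thesis by (simp add: s_def t_def)
qed

text \<open>
  The exponent \<open>\<eta>\<close> for which \<open>x powr (- \<eta>)\<close> is the bound of the preceding lemma with
  \<open>L = max 1 (ln (1 / x))\<close>, for \<open>0 < x < 1\<close>.
\<close>
definition loss_exponent :: "real \<Rightarrow> real" where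
  "loss_exponent x = (let L = max 1 (ln (1 / x)) in
     ln (12 * (1 + L)\<^sup>2 * exp (L powr (3/4) + 2 * L powr (1/2))) / ln (1 / x))"

lemma loss_exponent_tendsto: "(loss_exponent \<longlongrightarrow> 0) (at_right 0)"
proof -
  have "((\<lambda>x::real. ln (12 * (1 + ln (1 / x))\<^sup>2 * exp (ln (1 / x) powr (3/4) + 2 * ln (1 / x) powr (1/2)))
      / ln (1 / x)) \<longlongrightarrow> 0) (at_right 0)" by real_asymp
  moreover have "eventually (\<lambda>x::real. ln (1 / x) \<ge> 1) (at_right 0)" by real_asymp
  then have "eventually (\<lambda>x. ln (12 * (1 + ln (1 / x))\<^sup>2 * exp (ln (1 / x) powr (3/4) + 2 * ln (1 / x) powr (1/2)))
      / ln (1 / x) = loss_exponent x) (at_right 0)"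
    by eventually_elim (simp add: loss_exponent_def Let_def max_absorb2)
  ultimately show ?thesis by (rule Lim_transform_eventually)
qed

section \<open>Angular regularization of the joint construction\<close>

theorem theorem7p2:
  shows "\<exists>(C::real) (C1::real) (\<eta>::real \<Rightarrow> real). (\<eta> \<longlongrightarrow> 0) (at_right 0) \<and>
    (\<forall>S k0 E1 w0 d0. valid_setting S \<and> joint_construction S k0 E1 w0 d0 \<longrightarrow>
      (\<exists>E_ang (d_ang::nat) (\<theta>::real) (c_ang::real).
        E_ang \<subseteq> degree_class E1 d0 \<and> dyadic d_ang \<and> \<theta> \<in> {q_res S..1} \<and> 0 < c_ang \<and>
        (\<forall>Q. parents_at E_ang Q \<noteq> {} \<longrightarrow>
          card (parents_at E_ang Q) \<in> {d_ang..<2 * d_ang}) \<and>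
        (\<forall>Q. parents_at E_ang Q \<noteq> {} \<longrightarrow>
          resolved_diameter S (q_res S) (parents_at E_ang Q) \<in> {\<theta>..<2 * \<theta>}) \<and>
        (\<forall>Q. parents_at E_ang Q \<noteq> {} \<longrightarrow>
          (\<forall>H \<subseteq> parents_at E_ang Q.
            real (card H) \<ge> inverse (A_ang S) * real (card (parents_at E_ang Q)) \<longrightarrow>
            resolved_diameter S (q_res S) H > \<theta> / B_ang S)) \<and>
        (\<Sum>B\<in>parents S. measure lebesgue (cell_shading E_ang B))
          \<ge> c_ang * (\<Sum>B\<in>parents S. measure lebesgue (cell_shading (degree_class E1 d0) B)) \<and>
        c_ang \<ge> inverse (A_ang S ^ K_ang S) / (J_theta S * J_d S) \<and>
        inverse c_ang
          \<le> C * (1 + L_plus S)\<^sup>2 * exp (L_plus S powr (3/4) + 2 * L_plus S powr (1/2)) \<and>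
        (L_0 S \<le> 1 \<longrightarrow> inverse c_ang \<le> C1) \<and>
        (alpha S < 1 \<longrightarrow> (\<exists>\<epsilon>. \<bar>\<epsilon>\<bar> \<le> \<eta> (alpha S) \<and> c_ang = alpha S powr \<epsilon>)) \<and>
        shading_mass S (\<lambda>B T. Y1 S k0 (degree_class E1 d0) B T \<inter> cell_shading E_ang B)
          \<ge> c_ang / 2 * shading_mass S (Y1 S k0 (degree_class E1 d0))))"
proof (rule exI[of _ 12], rule exI[of _ "48 * exp 3"], rule exI[of _ loss_exponent],
    intro conjI allI impI)
  show "(loss_exponent \<longlongrightarrow> 0) (at_right 0)" by (rule loss_exponent_tendsto)
next
  fix S k0 E1 w0 d0
  assume "valid_setting S \<and> joint_construction S k0 E1 w0 d0"
  then have S: "valid_setting S" and J: "joint_construction S k0 E1 w0 d0" by auto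
  define E2 where "E2 = degree_class E1 d0"
  define q where "q = q_res S"
  have side: "0 < side_a S" "side_a S \<le> side_b S" "side_b S \<le> side_r S"
    using S by (auto simp: valid_setting_def)
  have q: "0 < q" "q \<le> 1" using side by (auto simp: q_def q_res_def)
  have lnq: "ln (1 / q) \<le> L_0 S"
    using side by (auto simp: q_def q_res_def L_0_def alpha_def divide_right_mono)
  have L: "1 \<le> L_plus S" "L_0 S \<le> L_plus S" by (auto simp: L_plus_def)
  have A: "1 \<le> A_ang S" and B: "1 < B_ang S" using L by (auto simp: A_ang_def B_ang_def)
  have E1: "E1 \<subseteq> E_plus S k0" and w0: "0 < w0"
    and w: "\<And>e. e \<in> E1 \<Longrightarrow> w0 \<le> edge_weight S k0 e \<and> edge_weight S k0 e < 2 * w0"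
    and d0: "dyadic d0"
    using J by (auto simp: joint_construction_def)
  have E2E1: "E2 \<subseteq> E1" by (auto simp: E2_def degree_class_def)
  have E2: "E2 \<subseteq> E_plus S k0" using E2E1 E1 by auto
  have fin2: "finite E2" using E2 finite_E_plus[OF S] by (rule finite_subset)
  obtain m where m: "d0 = 2 ^ m" using d0 by (auto simp: dyadic_def)
  \<comment> \<open>Membership in a degree class depends on the cell only, so the fibres of \<open>E2\<close> are
    whole fibres of \<open>E1\<close>.\<close>
  have deg: "2 ^ m \<le> card {p. (p, Q) \<in> E2} \<and> card {p. (p, Q) \<in> E2} < 2 * 2 ^ m"
    if "{p. (p, Q) \<in> E2} \<noteq> {}" for Q
  proof -
    have "{p. (p, Q) \<in> E2} = parents_at E1 Q"
      using that by (auto simp: E2_def degree_class_def parents_at_def)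
    then show ?thesis using that by (auto simp: E2_def degree_class_def m)
  qed
  define c where "c = inverse (A_ang S ^ K_ang S) / (J_theta S * J_d S)"
  have "\<exists>E' (i::nat) \<theta>. E' \<subseteq> E2 \<and> \<theta> \<in> {q..1} \<and>
    (\<forall>Q. parents_at E' Q \<noteq> {} \<longrightarrow>
      card (parents_at E' Q) \<in> {2 ^ i..<2 * 2 ^ i} \<and>
      resolved_diameter S q (parents_at E' Q) \<in> {\<theta>..<2 * \<theta>} \<and>
      (\<forall>H\<subseteq>parents_at E' Q. real (card H) \<ge> inverse (A_ang S) * real (card (parents_at E' Q))
        \<longrightarrow> resolved_diameter S q H > \<theta> / B_ang S)) \<and>
    real (card E') \<ge> c * real (card E2)"
    unfolding parents_at_def c_def K_ang_def J_theta_def J_d_def q_def[symmetric]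
    by (rule scale_regular_subgraph[OF fin2 deg q A B resolved_diameter_bounds[OF q(2)]])
  then obtain E' i \<theta> where E': "E' \<subseteq> E2" "\<theta> \<in> {q..1}"
    and reg: "\<And>Q. parents_at E' Q \<noteq> {} \<Longrightarrow>
      card (parents_at E' Q) \<in> {2 ^ i..<2 * 2 ^ i} \<and>
      resolved_diameter S q (parents_at E' Q) \<in> {\<theta>..<2 * \<theta>} \<and>
      (\<forall>H\<subseteq>parents_at E' Q. real (card H) \<ge> inverse (A_ang S) * real (card (parents_at E' Q))
        \<longrightarrow> resolved_diameter S q H > \<theta> / B_ang S)"
    and cc: "real (card E') \<ge> c * real (card E2)"
    by (elim exE conjE) (rule that, blast+)
  have AK: "1 \<le> A_ang S ^ K_ang S" using A by (rule one_le_power)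
  then have "1 \<le> 2 * A_ang S ^ K_ang S" by linarith
  then have "0 \<le> log 2 (2 * A_ang S ^ K_ang S)" by simp
  moreover have "0 \<le> log 2 (1 / q)" using q by simp
  ultimately have J1: "1 \<le> J_theta S" "1 \<le> J_d S" unfolding J_theta_def J_d_def q_def by linarith+
  then have JJ: "1 \<le> real_of_int (J_theta S * J_d S)"
    by (metis mult_mono' mult_1 of_int_1_le_iff zero_le_one)
  have ic: "inverse c = A_ang S ^ K_ang S * real_of_int (J_theta S * J_d S)"
    by (simp add: c_def divide_inverse)
  have c0: "0 < c" using JJ A by (simp add: c_def zero_less_power)
  define R where "R = 12 * (1 + L_plus S)\<^sup>2 * exp (L_plus S powr (3/4) + 2 * L_plus S powr (1/2))"
  have bound: "inverse c \<le> R"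
    using angular_loss_bound[OF L(1) q] lnq L(2)
    by (simp add: R_def ic A_ang_def K_ang_def B_ang_def J_theta_def J_d_def q_def)
  have ic1: "1 \<le> inverse c" unfolding ic using JJ AK
    by (metis mult_mono' mult_1 zero_le_one)
  have vol: "(\<Sum>B\<in>parents S. measure lebesgue (cell_shading E B)) =
      measure lebesgue (cell (mesh S) 0) * real (card E)" if "E \<subseteq> E2" for E
  proof (rule sum_measure_cell_shading[OF mesh_pos[OF S] finite_subset[OF that fin2]])
    show "finite (parents S)" using S by (simp add: valid_setting_def)
    show "E \<subseteq> parents S \<times> range (cell (mesh S))" using that E2 by (auto simp: E_plus_def cells_def)
  qed
  have mass2: "shading_mass S (Y1 S k0 E2) = sum (edge_weight S k0) E2"
    using shading_mass_cell_shading[OF S E2] by (simp add: shading_mass_def Y1_def)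
  have "Y1 S k0 E2 B T \<inter> cell_shading E' B = Y0 S k0 B T \<inter> cell_shading E' B" for B T
    using E'(1) by (auto simp: Y1_def cell_shading_def)
  then have mass': "shading_mass S (\<lambda>B T. Y1 S k0 E2 B T \<inter> cell_shading E' B) = sum (edge_weight S k0) E'"
    using shading_mass_cell_shading[OF S order_trans[OF E'(1) E2]] by simp
  \<comment> \<open>Weights on \<open>E1\<close> agree up to a factor two, which is the factor lost in passing from
    numbers of edges to masses.\<close>
  have "sum (edge_weight S k0) E2 \<le> real (card E2) * (2 * w0)"
    using w E2E1 by (intro sum_bounded_above) (auto intro: less_imp_le)
  then have "c / 2 * sum (edge_weight S k0) E2 \<le> c / 2 * (real (card E2) * (2 * w0))"
    using c0 by (intro mult_left_mono) auto
  also have "\<dots> = (c * real (card E2)) * w0" by simp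
  also have "\<dots> \<le> real (card E') * w0" using cc w0 by (intro mult_right_mono) auto
  also have "\<dots> \<le> sum (edge_weight S k0) E'"
    using w E2E1 E'(1) by (intro sum_bounded_below) auto
  finally have mass: "c / 2 * sum (edge_weight S k0) E2 \<le> sum (edge_weight S k0) E'" .
  have \<epsilon>: "\<exists>\<epsilon>. \<bar>\<epsilon>\<bar> \<le> loss_exponent (alpha S) \<and> c = alpha S powr \<epsilon>" if al: "alpha S < 1"
  proof (intro exI conjI)
    have a0: "0 < alpha S" using side by (simp add: alpha_def)
    have l0: "0 < ln (1 / alpha S)" using a0 al by simp
    have "0 \<le> ln (inverse c)" "ln (inverse c) \<le> ln R"
      using bound ic1 c0 by (auto intro!: ln_mono)
    then have "\<bar>ln (inverse c) / ln (1 / alpha S)\<bar> \<le> ln R / ln (1 / alpha S)"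
      using l0 by (simp add: abs_divide divide_right_mono)
    then show "\<bar>ln (inverse c) / ln (1 / alpha S)\<bar> \<le> loss_exponent (alpha S)"
      by (simp add: loss_exponent_def R_def L_plus_def L_0_def Let_def)
    show "c = alpha S powr (ln (inverse c) / ln (1 / alpha S))"
      using a0 c0 l0 by (simp add: powr_def ln_inverse ln_div)
  qed
  show "\<exists>E_ang (d_ang::nat) (\<theta>::real) (c_ang::real).
        E_ang \<subseteq> degree_class E1 d0 \<and> dyadic d_ang \<and> \<theta> \<in> {q_res S..1} \<and> 0 < c_ang \<and>
        (\<forall>Q. parents_at E_ang Q \<noteq> {} \<longrightarrow>
          card (parents_at E_ang Q) \<in> {d_ang..<2 * d_ang}) \<and>
        (\<forall>Q. parents_at E_ang Q \<noteq> {} \<longrightarrow>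
          resolved_diameter S (q_res S) (parents_at E_ang Q) \<in> {\<theta>..<2 * \<theta>}) \<and>
        (\<forall>Q. parents_at E_ang Q \<noteq> {} \<longrightarrow>
          (\<forall>H \<subseteq> parents_at E_ang Q.
            real (card H) \<ge> inverse (A_ang S) * real (card (parents_at E_ang Q)) \<longrightarrow>
            resolved_diameter S (q_res S) H > \<theta> / B_ang S)) \<and>
        (\<Sum>B\<in>parents S. measure lebesgue (cell_shading E_ang B))
          \<ge> c_ang * (\<Sum>B\<in>parents S. measure lebesgue (cell_shading (degree_class E1 d0) B)) \<and>
        c_ang \<ge> inverse (A_ang S ^ K_ang S) / (J_theta S * J_d S) \<and>
        inverse c_ang
          \<le> 12 * (1 + L_plus S)\<^sup>2 * exp (L_plus S powr (3/4) + 2 * L_plus S powr (1/2)) \<and>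
        (L_0 S \<le> 1 \<longrightarrow> inverse c_ang \<le> 48 * exp 3) \<and>
        (alpha S < 1 \<longrightarrow> (\<exists>\<epsilon>. \<bar>\<epsilon>\<bar> \<le> loss_exponent (alpha S) \<and> c_ang = alpha S powr \<epsilon>)) \<and>
        shading_mass S (\<lambda>B T. Y1 S k0 (degree_class E1 d0) B T \<inter> cell_shading E_ang B)
          \<ge> c_ang / 2 * shading_mass S (Y1 S k0 (degree_class E1 d0))"
    unfolding E2_def[symmetric] q_def[symmetric] R_def[symmetric] c_def[symmetric]
  proof (rule exI[of _ E'], rule exI[of _ "2 ^ i"], rule exI[of _ \<theta>], rule exI[of _ c],
      intro conjI allI impI)
    show "c * (\<Sum>B\<in>parents S. measure lebesgue (cell_shading E2 B))
      \<le> (\<Sum>B\<in>parents S. measure lebesgue (cell_shading E' B))"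
      unfolding vol[OF E'(1)] vol[OF order_refl]
      using mult_left_mono[OF cc, of "measure lebesgue (cell (mesh S) 0)"] by (simp add: mult_ac)
    \<comment> \<open>Here \<open>L_plus S = 1\<close>, and the general bound is \<open>12 * 2\<^sup>2 * exp (1 + 2)\<close>.\<close>
    show "inverse c \<le> 48 * exp 3" if "L_0 S \<le> 1"
      using bound that by (simp add: R_def L_plus_def)
    show "\<exists>\<epsilon>. \<bar>\<epsilon>\<bar> \<le> loss_exponent (alpha S) \<and> c = alpha S powr \<epsilon>" if "alpha S < 1"
      using \<epsilon> that .
  qed (use E' reg c0 bound mass in \<open>auto simp: dyadic_def mass2 mass'\<close>)
qed

end
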